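(* Let $l\geqslant 1$ be an integer and let $n\geqslant l+3$ be an integer. Then $$\kappa_l(n,3)=\begin{cases}\lfloor (n+l)/2\rfloor, & l+3\leqslant n<3l;\\ l+\lfloor n/3\rfloor, & n\geqslant \max\{3l,l+3\}.\end{cases}$$
   Context: For a positive integer $n$, $[n]=\{1,\ldots,n\}$. A family $\mathcal{F}$ of subsets of $[n]$ is an $m$-family if it has $m$ members (required to be pairwise distinct subsets); it is $k$-uniform if every member has size $k$; for a set $L$ of nonnegative integers it is $L$-intersecting if $|F\cap F'|\in L$ for every two distinct members $F,F'$. $\kappa_{L}(n,m)$ denotes the maximum $k$ such that there exists a $k$-uniform $L$-intersecting $m$-family of subsets of $[n]$ (and $-\infty$ if none exists), and $\kappa_l(n,m)$ denotes $\kappa_{\{l\}}(n,m)$. *)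

theory Defs
  imports Complex_Main "HOL-Library.Extended_Real"
begin

definition family_on :: "nat \<Rightarrow> nat \<Rightarrow> nat set set \<Rightarrow> bool" where
  "family_on n m \<F> \<longleftrightarrow> \<F> \<subseteq> Pow {1..n} \<and> card \<F> = m"

definition uniform :: "nat \<Rightarrow> 'a set set \<Rightarrow> bool" where
  "uniform k \<F> \<longleftrightarrow> (\<forall>F\<in>\<F>. card F = k)"

definition intersecting :: "nat set \<Rightarrow> 'a set set \<Rightarrow> bool" where
  "intersecting L \<F> \<longleftrightarrow> (\<forall>F\<in>\<F>. \<forall>F'\<in>\<F>. F \<noteq> F' \<longrightarrow> card (F \<inter> F') \<in> L)"

definition feasible_sizes :: "nat set \<Rightarrow> nat \<Rightarrow> nat \<Rightarrow> nat set" where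
  "feasible_sizes L n m = {k. \<exists>\<F>. family_on n m \<F> \<and> uniform k \<F> \<and> intersecting L \<F>}"

(* For m > 0 the feasible sizes are bounded by n, so the maximum is attained.
   For m = 0 every k is feasible (empty family) and Max has no meaning. *)
definition kappa :: "nat set \<Rightarrow> nat \<Rightarrow> nat \<Rightarrow> ereal" where
  "kappa L n m =
     (if feasible_sizes L n m = {} then -\<infinity> else ereal (real (Max (feasible_sizes L n m))))"

end

theory Submission
  imports Defs
begin

text \<open>Let \<open>A\<close>, \<open>B\<close>, \<open>C\<close> have size \<open>k\<close> and meet pairwise in \<open>l\<close> points. Then
  \<open>A \<union> B\<close> has \<open>2k - l\<close> elements, and \<open>C\<close> meets it in at most \<open>2l\<close> points, so
  \<open>2k - l \<le> n\<close> and \<open>3k - 3l \<le> n\<close>. Conversely, whenever \<open>k > l\<close> satisfies these two bounds,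
  one obtains such a triple with \<open>max(0, 2l - k)\<close> points common to all three sets.
  The two bounds on \<open>k\<close> cross at \<open>n = 3l\<close>.\<close>

lemma feasible_three_bounds:
  assumes "k \<in> feasible_sizes {l} n 3"
  shows "l < k" and "2 * k \<le> n + l" and "3 * k \<le> n + 3 * l"
proof -
  obtain \<F> where \<F>: "\<F> \<subseteq> Pow {1..n}" "card \<F> = 3" "uniform k \<F>" "intersecting {l} \<F>"
    using assms by (auto simp: feasible_sizes_def family_on_def)
  obtain A B C where ABC: "\<F> = {A, B, C}" "A \<noteq> B" "A \<noteq> C" "B \<noteq> C"
    using \<F>(2) by (auto simp: card_3_iff)
  have sub: "A \<union> B \<union> C \<subseteq> {1..n}"
    using \<F>(1) ABC by auto
  have fin: "finite A" "finite B" "finite C"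
    using sub by (auto intro: finite_subset)
  have size: "card A = k" "card B = k" "card C = k"
    using \<F>(3) ABC by (auto simp: uniform_def)
  have inter: "card (A \<inter> B) = l" "card (A \<inter> C) = l" "card (B \<inter> C) = l"
    using \<F>(4) ABC by (auto simp: intersecting_def)
  have "l \<le> k"
    using card_mono[of A "A \<inter> B"] fin size inter by auto
  \<comment> \<open>Strictness comes from distinctness: with \<open>l = k\<close> the intersection
    would fill both \<open>A\<close> and \<open>B\<close>.\<close>
  moreover have "l \<noteq> k"
  proof
    assume "l = k"
    then have "A \<inter> B = A" "A \<inter> B = B"
      using card_subset_eq[of A "A \<inter> B"] card_subset_eq[of B "A \<inter> B"] fin size inter by auto
    with ABC(2) show False by blast
  qed
  ultimately show "l < k" by simp
  have AB: "card (A \<union> B) + l = 2 * k"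
    using card_Un_Int[of A B] fin size inter by simp
  have "card (A \<union> B) \<le> n"
    using card_mono[of "{1..n}" "A \<union> B"] sub by simp
  with AB show "2 * k \<le> n + l" by simp
  have "card ((A \<union> B) \<inter> C) \<le> 2 * l"
    using card_Un_le[of "A \<inter> C" "B \<inter> C"] inter by (simp add: Int_Un_distrib2)
  moreover have "card (A \<union> B) + k = card (A \<union> B \<union> C) + card ((A \<union> B) \<inter> C)"
    using card_Un_Int[of "A \<union> B" C] fin size by simp
  moreover have "card (A \<union> B \<union> C) \<le> n"
    using card_mono[of "{1..n}" "A \<union> B \<union> C"] sub by simp
  ultimately show "3 * k \<le> n + 3 * l"
    using AB by linarith
qed

lemma feasible_three_construction:
  assumes "l < k" and "2 * k \<le> n + l" and "3 * k \<le> n + 3 * l"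
  shows "k \<in> feasible_sizes {l} n 3"
proof -
  \<comment> \<open>Subtraction truncates at 0, so at most one of \<open>t\<close> and
    \<open>q\<close> is nonzero: a common core is needed only when \<open>k < 2 * l\<close>, points
    of \<open>C\<close> outside \<open>A \<union> B\<close> only when
    \<open>k > 2 * l\<close>.\<close>
  define t where "t = 2 * l - k"
  define p where "p = l - t"
  define q where "q = k - 2 * l"
  \<comment> \<open>The last inequality is the third assumption if \<open>k \<ge> 2 * l\<close>, and
    the second otherwise.\<close>
  have sizes: "t + p = l" "l + p \<le> k" "t + 2 * p + q = k" "2 * k - l + q \<le> n"
    using assms by (auto simp: t_def p_def q_def)
  \<comment> \<open>The four blocks of \<open>C\<close> lie, in order, in
    \<open>A \<inter> B\<close> (the first two positions of the layout being split at
    \<open>l\<close>), in \<open>A - B\<close>, in \<open>B - A\<close> and beyond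
    \<open>A \<union> B\<close>, which is \<open>{0<..2 * k - l}\<close>.\<close>
  define A B C where "A = {0<..k}"
    and "B = {0<..l} \<union> {k<..2 * k - l}"
    and "C = {0<..t} \<union> {l<..l + p} \<union> {k<..k + p} \<union> {2 * k - l<..2 * k - l + q}"
  have size: "card A = k" "card B = k" "card C = k"
  proof -
    show "card A = k" by (simp add: A_def)
    show "card B = k"
      unfolding B_def by (subst card_Un_disjoint) (use assms in auto)
    have "card C = card ({0<..t} \<union> {l<..l + p} \<union> {k<..k + p}) + q"
      unfolding C_def by (subst card_Un_disjoint) (use assms sizes in auto)
    also have "card ({0<..t} \<union> {l<..l + p} \<union> {k<..k + p}) = card ({0<..t} \<union> {l<..l + p}) + p"
      by (subst card_Un_disjoint) (use sizes in auto)
    also have "card ({0<..t} \<union> {l<..l + p}) = t + p"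
      by (subst card_Un_disjoint) (use sizes in auto)
    finally show "card C = k" using sizes by simp
  qed
  have inter: "card (A \<inter> B) = l" "card (A \<inter> C) = l" "card (B \<inter> C) = l"
  proof -
    have "A \<inter> B = {0<..l}"
      using assms by (auto simp: A_def B_def)
    then show "card (A \<inter> B) = l" by simp
    have "A \<inter> C = {0<..t} \<union> {l<..l + p}"
      using assms sizes by (auto simp: A_def C_def)
    also have "card \<dots> = l"
      by (subst card_Un_disjoint) (use sizes in auto)
    finally show "card (A \<inter> C) = l" .
    have "B \<inter> C = {0<..t} \<union> {k<..k + p}"
      using assms sizes by (auto simp: B_def C_def)
    also have "card \<dots> = l"
      by (subst card_Un_disjoint) (use assms sizes in auto)
    finally show "card (B \<inter> C) = l" .
  qed
  \<comment> \<open>Two equal sets would meet in \<open>k > l\<close> points.\<close>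
  have "A \<noteq> B" "A \<noteq> C" "B \<noteq> C"
    using size inter assms(1) by auto
  then have "card {A, B, C} = 3" by simp
  moreover have "{A, B, C} \<subseteq> Pow {1..n}"
    using assms sizes by (auto simp: A_def B_def C_def)
  moreover have "uniform k {A, B, C}"
    using size by (simp add: uniform_def)
  moreover have "intersecting {l} {A, B, C}"
    using inter by (simp add: intersecting_def Int_commute)
  ultimately show ?thesis
    unfolding feasible_sizes_def family_on_def by blast
qed

lemma feasible_sizes_three:
  "feasible_sizes {l} n 3 = {k. l < k \<and> 2 * k \<le> n + l \<and> 3 * k \<le> n + 3 * l}"
  using feasible_three_bounds feasible_three_construction by blast

text \<open>The upper bound also makes the set of sizes finite, so that \<open>Max\<close> is
  meaningful.\<close>

lemma kappa_eqI:
  assumes "k \<in> feasible_sizes L n m" and "\<And>j. j \<in> feasible_sizes L n m \<Longrightarrow> j \<le> k"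
  shows "kappa L n m = ereal (real k)"
proof -
  have "finite (feasible_sizes L n m)"
    using assms(2) by (auto intro: finite_subset[of _ "{..k}"])
  then have "Max (feasible_sizes L n m) = k"
    using assms by (intro Max_eqI)
  with assms(1) show ?thesis by (auto simp: kappa_def)
qed

theorem theorem2p3:
  fixes l n :: nat
  assumes "l \<ge> 1" and "n \<ge> l + 3"
  shows "(l + 3 \<le> n \<and> n < 3 * l \<longrightarrow>
            kappa {l} n 3 = ereal (real_of_int \<lfloor>(real n + real l) / 2\<rfloor>)) \<and>
         (n \<ge> max (3 * l) (l + 3) \<longrightarrow>
            kappa {l} n 3 = ereal (real l + real_of_int \<lfloor>real n / 3\<rfloor>))"
proof (intro conjI impI)
  assume "l + 3 \<le> n \<and> n < 3 * l"
  \<comment> \<open>For \<open>n < 3 * l\<close>, \<open>2 * k \<le> n + l\<close> implies the other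
    upper bound, since 3(n + l)/2 \<le> n + 3l. The maximum exceeds \<open>l\<close> because
    \<open>n \<ge> l + 3\<close>.\<close>
  then have "kappa {l} n 3 = ereal (real ((n + l) div 2))"
    by (intro kappa_eqI) (auto simp: feasible_sizes_three)
  moreover have "\<lfloor>(real n + real l) / 2\<rfloor> = int ((n + l) div 2)"
    using floor_divide_of_nat_eq[of "n + l" 2, where 'a = real] by simp
  ultimately show "kappa {l} n 3 = ereal (real_of_int \<lfloor>(real n + real l) / 2\<rfloor>)"
    by simp
next
  assume "n \<ge> max (3 * l) (l + 3)"
  \<comment> \<open>For \<open>n \<ge> 3 * l\<close>, \<open>3 * k \<le> n + 3 * l\<close> is the
    stronger bound, since 2l + 2n/3 \<le> n + l. The maximum exceeds \<open>l\<close> because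
    \<open>n \<ge> 3\<close>.\<close>
  then have "kappa {l} n 3 = ereal (real (l + n div 3))"
    by (intro kappa_eqI) (auto simp: feasible_sizes_three)
  moreover have "\<lfloor>real n / 3\<rfloor> = int (n div 3)"
    using floor_divide_of_nat_eq[of n 3, where 'a = real] by simp
  ultimately show "kappa {l} n 3 = ereal (real l + real_of_int \<lfloor>real n / 3\<rfloor>)"
    by simp
qed

end
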